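(* Let $\hat M$ be a simplification of the VCG sponsored search mechanism that is Vickrey-preserving on $\Psi$. Then for every $\theta\in\Psi$ and every $\epsilon>0$ there exists an efficient Nash equilibrium of $\hat M$ for $\theta$ with revenue at most $\epsilon$.
   Context: Sponsored search setting: agents $N=\{1,\dots,n\}$, slots $1,\dots,k$ with $k\le n$; an outcome assigns agents to distinct positions, position $j\le k$ meaning slot $j$, others getting nothing (value 0); utilities quasilinear. $\mathbb{R}^n_{>}$: vectors $\beta$ with $1=\beta_1>\dots>\beta_k>0$ and $\beta_j=0$ for $j>k$. $\Theta^\beta$: type profiles where agent $i$ has $v_i(\theta_i)\ge0$ and values slot $j$ at $\beta_j v_i(\theta_i)$; $\Psi=\bigcup_{\beta\in\mathbb{R}^n_{>}}\Theta^\beta$. VCG mechanism: each agent $i$ sends a message consisting of a bid $x_{i,j}$ for each slot $j$; an assignment maximizing total bids is chosen; agent $i$ pays the Clarke payment (max total bid of the others over all assignments minus others' total bid in the chosen assignment). The VCG outcome for $\theta$ is the result under truthful bids. A simplification $\hat M$ of VCG restricts each agent's message set to some subset $\hat X_i$ of bid vectors, keeping the VCG assignment and payment rule on the restricted messages. Vickrey-preserving on $\Psi$: for every $\theta\in\Psi$, $\hat M$ has a Nash equilibrium for $\theta$ yielding the VCG outcome for $\theta$. Nash equilibrium (complete information): no agent can strictly gain by unilateral deviation within $\hat X_i$; efficient: the assignment maximizes total true value. Revenue: sum of payments. *)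

theory Defs
  imports Complex_Main "HOL-Combinatorics.Permutations"
begin

(* Conventions (0-indexed): agents are 0..<n, positions are 0..<n,
   position p < k is slot p+1 of the paper; positions p >= k give nothing.
   A bid profile / valuation profile is  b :: nat => nat => real,
   b i j = agent i's bid (value) for slot j (j < k); entries with j >= k or i >= n
   are ignored. An outcome's assignment is a permutation of {..<n}
   (agent i gets position sigma i). *)

type_synonym profile = "nat \<Rightarrow> nat \<Rightarrow> real"

definition assignments :: "nat \<Rightarrow> (nat \<Rightarrow> nat) set" where
  "assignments n = {\<sigma>. \<sigma> permutes {..<n}}"

definition posval :: "nat \<Rightarrow> profile \<Rightarrow> nat \<Rightarrow> nat \<Rightarrow> real" where
  "posval k b i p = (if p < k then b i p else 0)"

definition total :: "nat \<Rightarrow> profile \<Rightarrow> (nat \<Rightarrow> nat) \<Rightarrow> nat set \<Rightarrow> real" where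
  "total k b \<sigma> A = (\<Sum>i\<in>A. posval k b i (\<sigma> i))"

definition same_bids :: "nat \<Rightarrow> nat \<Rightarrow> profile \<Rightarrow> profile \<Rightarrow> bool" where
  "same_bids n k b b' \<longleftrightarrow> (\<forall>i<n. \<forall>j<k. b i j = b' i j)"

definition vcg_rule :: "nat \<Rightarrow> nat \<Rightarrow> (profile \<Rightarrow> (nat \<Rightarrow> nat)) \<Rightarrow> bool" where
  "vcg_rule n k sel \<longleftrightarrow>
     (\<forall>b. sel b \<in> assignments n \<and>
          (\<forall>\<sigma>\<in>assignments n. total k b \<sigma> {..<n} \<le> total k b (sel b) {..<n})) \<and>
     (\<forall>b b'. same_bids n k b b' \<longrightarrow> sel b = sel b')"

definition payment :: "nat \<Rightarrow> nat \<Rightarrow> (profile \<Rightarrow> (nat \<Rightarrow> nat)) \<Rightarrow> profile \<Rightarrow> nat \<Rightarrow> real" where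
  "payment n k sel b i =
     (MAX \<sigma>\<in>assignments n. total k b \<sigma> ({..<n} - {i})) - total k b (sel b) ({..<n} - {i})"

definition revenue :: "nat \<Rightarrow> nat \<Rightarrow> (profile \<Rightarrow> (nat \<Rightarrow> nat)) \<Rightarrow> profile \<Rightarrow> real" where
  "revenue n k sel b = (\<Sum>i<n. payment n k sel b i)"

definition utility :: "nat \<Rightarrow> nat \<Rightarrow> (profile \<Rightarrow> (nat \<Rightarrow> nat)) \<Rightarrow> profile \<Rightarrow> profile \<Rightarrow> nat \<Rightarrow> real" where
  "utility n k sel \<theta> m i = posval k \<theta> i (sel m i) - payment n k sel m i"

(* the simplification restricts agent i's messages to X i *)
definition nash :: "nat \<Rightarrow> nat \<Rightarrow> (profile \<Rightarrow> (nat \<Rightarrow> nat)) \<Rightarrow> (nat \<Rightarrow> (nat \<Rightarrow> real) set)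
                     \<Rightarrow> profile \<Rightarrow> profile \<Rightarrow> bool" where
  "nash n k sel X \<theta> m \<longleftrightarrow>
     (\<forall>i<n. m i \<in> X i) \<and>
     (\<forall>i<n. \<forall>x\<in>X i. utility n k sel \<theta> (m(i := x)) i \<le> utility n k sel \<theta> m i)"

definition efficient :: "nat \<Rightarrow> nat \<Rightarrow> profile \<Rightarrow> (nat \<Rightarrow> nat) \<Rightarrow> bool" where
  "efficient n k \<theta> \<sigma> \<longleftrightarrow> \<sigma> \<in> assignments n \<and>
     (\<forall>\<tau>\<in>assignments n. total k \<theta> \<tau> {..<n} \<le> total k \<theta> \<sigma> {..<n})"

definition good_beta :: "nat \<Rightarrow> (nat \<Rightarrow> real) \<Rightarrow> bool" where
  "good_beta k \<beta> \<longleftrightarrow> \<beta> 0 = 1 \<and> (\<forall>j. Suc j < k \<longrightarrow> \<beta> (Suc j) < \<beta> j) \<and>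
     (\<forall>j<k. \<beta> j > 0) \<and> (\<forall>j\<ge>k. \<beta> j = 0)"

definition Psi :: "nat \<Rightarrow> nat \<Rightarrow> profile \<Rightarrow> bool" where
  "Psi n k \<theta> \<longleftrightarrow> (\<exists>\<beta> v. good_beta k \<beta> \<and> (\<forall>i<n. v i \<ge> (0::real) \<and> (\<forall>j<k. \<theta> i j = \<beta> j * v i)))"

definition vickrey_preserving :: "nat \<Rightarrow> nat \<Rightarrow> (profile \<Rightarrow> (nat \<Rightarrow> nat))
                                    \<Rightarrow> (nat \<Rightarrow> (nat \<Rightarrow> real) set) \<Rightarrow> bool" where
  "vickrey_preserving n k sel X \<longleftrightarrow>
     (\<forall>\<theta>. Psi n k \<theta> \<longrightarrow> (\<exists>m. nash n k sel X \<theta> m \<and> sel m = sel \<theta> \<and>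
                                  (\<forall>i<n. payment n k sel m i = payment n k sel \<theta> i)))"

end

theory Submission
  imports Defs
begin

text \<open>
  Clarke payments are envy-free with respect to the \<^emph>\<open>reported\<close> bids. Apply this twice, to a
  Vickrey equilibrium \<open>m\<close> for a type profile \<open>(\<beta>, v)\<close> and to the truthful bids: since the assignment
  \<open>\<sigma>\<close> and the payments agree, agent \<open>i\<close>'s message cannot bid more than
  \<open>v j * (\<beta> q - \<beta> (\<sigma> i))\<close> extra on position \<open>q = \<sigma> j\<close> compared with its own position.
  So choose, for each slot \<open>l\<close>, values that are all close to a huge number and \<open>\<beta>\<close> close to 1 up to
  slot \<open>l\<close> and close to 0 after it: the agent destined for slot \<open>l\<close> then owns a message that bids at
  most slightly more on higher slots, and hugely less on all lower ones. Let every agent with a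
  valuable slot use such a message, taken from its own auxiliary profile. Nobody pays more than a
  little, moving up displaces somebody downwards and is therefore prohibitively expensive, and moving
  down loses more value than the small payment that it saves. The remaining agents get nothing of value, so
  their payment has to vanish exactly; their messages all come from one common profile in which
  they have value 0.
\<close>

section \<open>Envy-freeness of Clarke payments\<close>

text \<open>Read \<open>f a c\<close> as the value of \<open>a\<close> for the position that
  \<open>c\<close> holds in an optimal assignment, and \<pi> as an assignment evaluated without
  \<open>i\<close>. Follow \<pi> from \<open>j\<close>, stopping before \<open>i\<close>; the agents
  met form \<open>B\<close>. In \<rho> those other than \<open>j\<close> return to their own
  positions, while the agents outside \<open>B\<close> and different from \<open>i\<close> keep
  \<pi>. Optimality, tested on the cycle that runs along \<pi> through \<open>B\<close>, pays for
  the change.\<close>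

lemma exchange_at_optimum:
  fixes f :: "'a \<Rightarrow> 'a \<Rightarrow> real"
  assumes fin: "finite N" and i: "i \<in> N" and j: "j \<in> N" and pi: "\<pi> permutes N"
    and opt: "\<And>\<rho>. \<rho> permutes N \<Longrightarrow> (\<Sum>a\<in>N. f a (\<rho> a)) \<le> (\<Sum>a\<in>N. f a a)"
  shows "\<exists>\<rho>. \<rho> permutes N \<and>
    f i j + (\<Sum>a\<in>N - {i}. f a (\<pi> a)) \<le> f j j + (\<Sum>a\<in>N - {j}. f a (\<rho> a))"
proof (cases "i = j")
  case True
  with pi show ?thesis by auto
next
  case False
  define R where "R = {(a, \<pi> a) | a. \<pi> a \<noteq> i}"
  define B where "B = R\<^sup>* `` {j}"
  have inj: "\<pi> a = \<pi> b \<longleftrightarrow> a = b" for a b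
    using permutes_inj[OF pi] by (auto dest: injD)
  have piN: "\<pi> a \<in> N \<longleftrightarrow> a \<in> N" for a
    using permutes_in_image[OF pi] .
  have jB: "j \<in> B" by (simp add: B_def)
  have step: "\<pi> a \<in> B" if "a \<in> B" "\<pi> a \<noteq> i" for a
    using that unfolding B_def R_def by (auto intro: rtrancl_into_rtrancl)
  have pred: "a \<in> \<pi> ` B" if "a \<in> B" "a \<noteq> j" for a
  proof -
    from that have "(j, a) \<in> R\<^sup>*" by (simp add: B_def)
    then show ?thesis
      by (cases rule: rtranclE) (use that in \<open>auto simp: R_def B_def\<close>)
  qed
  have iB: "i \<notin> B"
  proof
    assume "i \<in> B"
    then have "(j, i) \<in> R\<^sup>*" by (simp add: B_def)
    then show False
      by (cases rule: rtranclE) (use False in \<open>auto simp: R_def\<close>)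
  qed
  have BN: "B \<subseteq> N"
  proof
    fix a assume "a \<in> B"
    then have "(j, a) \<in> R\<^sup>*" by (simp add: B_def)
    then show "a \<in> N"
      by (induction rule: rtrancl_induct) (use j piN in \<open>auto simp: R_def\<close>)
  qed
  have finB: "finite B" using BN fin finite_subset by blast
  have card: "card (\<pi> ` B) = card B"
    by (rule card_image) (auto simp: inj_on_def inj)
  define C where "C = N - B - {i}"
  have N: "N = insert i (B \<union> C)" and dis: "B \<inter> C = {}" "i \<notin> C" "j \<notin> C" and finC: "finite C"
    using BN i iB jB fin by (auto simp: C_def)
  have sumN: "(\<Sum>a\<in>N. g a) = g i + (\<Sum>a\<in>B. g a) + (\<Sum>a\<in>C. g a)" for g :: "'a \<Rightarrow> real"
    unfolding N using iB dis finB finC by (simp add: sum.union_disjoint)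
  have sumi: "(\<Sum>a\<in>N - {i}. g a) = (\<Sum>a\<in>B. g a) + (\<Sum>a\<in>C. g a)" for g :: "'a \<Rightarrow> real"
    using sumN[of g] sum.remove[OF fin i, of g] by simp
  have sumj: "(\<Sum>a\<in>N - {j}. g a) = g i + (\<Sum>a\<in>B - {j}. g a) + (\<Sum>a\<in>C. g a)" for g :: "'a \<Rightarrow> real"
    using sumN[of g] sum.remove[OF fin j, of g] sum.remove[OF finB jB, of g] by simp
  have dj: "(\<Sum>a\<in>B. f a a) = f j j + (\<Sum>a\<in>B - {j}. f a a)"
    using sum.remove[OF finB jB] .
  have permI: "\<rho> permutes N"
    if "\<And>a. a \<notin> N \<Longrightarrow> \<rho> a = a" "\<And>a. a \<in> N \<Longrightarrow> \<rho> a \<in> N" "inj_on \<rho> N" for \<rho> :: "'a \<Rightarrow> 'a"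
    using that fin by (intro bij_imp_permutes bij_betw_imageI endo_inj_surj) auto
  show ?thesis
  proof (cases "i \<in> \<pi> ` B")
    \<comment> \<open>The chain closes without meeting \<open>i\<close>, so \<open>B\<close> can use
      \<pi> on its own; in \<rho> agent \<open>i\<close> takes the position of
      \<open>j\<close>.\<close>
    case False
    then have "\<pi> ` B \<subseteq> B" using step by blast
    then have im: "\<pi> ` B = B" using card finB card_subset_eq by metis
    have mem: "\<pi> a \<in> B \<longleftrightarrow> a \<in> B" for a
      using im inj by (metis imageE imageI)
    define \<rho>1 where "\<rho>1 = (\<lambda>a. if a \<in> B then \<pi> a else a)"
    have "\<rho>1 permutes N"
      by (rule permI) (use BN piN mem inj in \<open>auto simp: \<rho>1_def inj_on_def\<close>)
    from opt[OF this] have "(\<Sum>a\<in>N. f a (\<rho>1 a)) \<le> (\<Sum>a\<in>N. f a a)" .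
    moreover have "(\<Sum>a\<in>B. f a (\<rho>1 a)) = (\<Sum>a\<in>B. f a (\<pi> a))"
      and "(\<Sum>a\<in>C. f a (\<rho>1 a)) = (\<Sum>a\<in>C. f a a)" "\<rho>1 i = i"
      using dis iB by (auto simp: \<rho>1_def intro!: sum.cong)
    ultimately have le: "(\<Sum>a\<in>B. f a (\<pi> a)) \<le> (\<Sum>a\<in>B. f a a)"
      by (simp add: sumN)
    \<comment> \<open>Agent \<open>j\<close> is left out of the sum over \<rho>, so it can absorb
      the leftover position \<open>\<pi> i\<close>.\<close>
    define \<rho> where "\<rho> = (\<lambda>a. if a = i then j else if a = j then \<pi> i else if a \<in> B then a else \<pi> a)"
    have "\<rho> permutes N"
    proof (rule permI)
      show "inj_on \<rho> N"
        unfolding inj_on_def \<rho>_def using mem inj iB jB \<open>i \<noteq> j\<close> by (smt (verit))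
    qed (use BN piN i j permutes_not_in[OF pi] in \<open>auto simp: \<rho>_def\<close>)
    moreover have "(\<Sum>a\<in>B - {j}. f a (\<rho> a)) = (\<Sum>a\<in>B - {j}. f a a)"
      and "(\<Sum>a\<in>C. f a (\<rho> a)) = (\<Sum>a\<in>C. f a (\<pi> a))" and "\<rho> i = j"
      using dis iB jB by (auto simp: \<rho>_def intro!: sum.cong split: if_splits)
    ultimately show ?thesis
      using le dj by (intro exI[of _ \<rho>]) (simp add: sumi sumj)
  next
    \<comment> \<open>The chain runs into \<open>i\<close>. Sending \<open>i\<close> to
      \<open>j\<close> closes it to the cycle \<open>\<rho>1\<close>, and in \<rho> agent
      \<open>i\<close> stays where it is.\<close>
    case True
    have "insert i (B - {j}) \<subseteq> \<pi> ` B" using True pred by blast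
    moreover have "card (insert i (B - {j})) = card (\<pi> ` B)"
      using card finB iB card_Suc_Diff1[OF finB jB] by simp
    ultimately have im: "\<pi> ` B = insert i (B - {j})"
      using finB card_subset_eq finite_imageI by metis
    have mem: "a \<in> B \<longleftrightarrow> \<pi> a = i \<or> \<pi> a \<in> B \<and> \<pi> a \<noteq> j" for a
    proof -
      have "a \<in> B \<longleftrightarrow> \<pi> a \<in> \<pi> ` B" using inj by (auto simp: image_iff)
      then show ?thesis unfolding im by blast
    qed
    define \<rho>1 where "\<rho>1 = (\<lambda>a. if a = i then j else if a \<in> B then \<pi> a else a)"
    have "\<rho>1 permutes N"
    proof (rule permI)
      show "inj_on \<rho>1 N"
        unfolding inj_on_def \<rho>1_def using mem inj iB jB \<open>i \<noteq> j\<close> by (smt (verit))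
    qed (use BN piN i j in \<open>auto simp: \<rho>1_def\<close>)
    from opt[OF this] have "(\<Sum>a\<in>N. f a (\<rho>1 a)) \<le> (\<Sum>a\<in>N. f a a)" .
    moreover have "(\<Sum>a\<in>B. f a (\<rho>1 a)) = (\<Sum>a\<in>B. f a (\<pi> a))"
      and "(\<Sum>a\<in>C. f a (\<rho>1 a)) = (\<Sum>a\<in>C. f a a)" "\<rho>1 i = j"
      using dis iB by (auto simp: \<rho>1_def intro!: sum.cong)
    ultimately have le: "f i j + (\<Sum>a\<in>B. f a (\<pi> a)) \<le> f i i + (\<Sum>a\<in>B. f a a)"
      by (simp add: sumN)
    define \<rho> where "\<rho> = (\<lambda>a. if a = j then \<pi> i else if a \<in> B \<or> a = i then a else \<pi> a)"
    have "\<rho> permutes N"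
    proof (rule permI)
      show "inj_on \<rho> N"
        unfolding inj_on_def \<rho>_def using mem inj iB jB \<open>i \<noteq> j\<close> by (smt (verit))
    qed (use BN piN i j permutes_not_in[OF pi] in \<open>auto simp: \<rho>_def\<close>)
    moreover have "(\<Sum>a\<in>B - {j}. f a (\<rho> a)) = (\<Sum>a\<in>B - {j}. f a a)"
      and "(\<Sum>a\<in>C. f a (\<rho> a)) = (\<Sum>a\<in>C. f a (\<pi> a))" and "\<rho> i = i"
      using dis iB jB \<open>i \<noteq> j\<close> by (auto simp: \<rho>_def intro!: sum.cong)
    ultimately show ?thesis
      using le dj by (intro exI[of _ \<rho>]) (simp add: sumi sumj)
  qed
qed

lemma finite_assignments: "finite (assignments n)"
  by (simp add: assignments_def finite_permutations)

lemma assignments_nonempty: "assignments n \<noteq> {}"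
  using permutes_id[of "{..<n}"] by (auto simp only: assignments_def)

lemma payment_ge:
  assumes "\<tau> \<in> assignments n"
  shows "total k b \<tau> ({..<n} - {i}) - total k b (sel b) ({..<n} - {i}) \<le> payment n k sel b i"
  unfolding payment_def using assms finite_assignments by simp

lemma payment_attained:
  obtains \<tau> where "\<tau> \<in> assignments n"
    "payment n k sel b i = total k b \<tau> ({..<n} - {i}) - total k b (sel b) ({..<n} - {i})"
proof -
  have "(MAX \<sigma>\<in>assignments n. total k b \<sigma> ({..<n} - {i}))
      \<in> (\<lambda>\<sigma>. total k b \<sigma> ({..<n} - {i})) ` assignments n"
    using finite_assignments assignments_nonempty by (intro Max_in) auto
  then show thesis using that unfolding payment_def by auto
qed

lemma vcg_rule_assignment: "vcg_rule n k sel \<Longrightarrow> sel b \<in> assignments n"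
  by (simp add: vcg_rule_def)

lemma vcg_rule_optimal:
  "vcg_rule n k sel \<Longrightarrow> \<tau> \<in> assignments n \<Longrightarrow> total k b \<tau> {..<n} \<le> total k b (sel b) {..<n}"
  by (simp add: vcg_rule_def)

lemma payment_nonneg:
  assumes "vcg_rule n k sel"
  shows "0 \<le> payment n k sel b i"
  using payment_ge[OF vcg_rule_assignment[OF assms, of b], of k b i sel] by simp

text \<open>An assignment attaining the maximum without \<open>i\<close> is turned by
  \<open>exchange_at_optimum\<close> into one that bounds the payment of \<open>j\<close> from
  below.\<close>

lemma clarke_payments_envy_free:
  assumes vcg: "vcg_rule n k sel" and i: "i < n" and j: "j < n"
  shows "posval k b i (sel b j) - payment n k sel b j
       \<le> posval k b i (sel b i) - payment n k sel b i"
proof -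
  let ?N = "{..<n}"
  define \<sigma> where "\<sigma> = sel b"
  have \<sigma>: "\<sigma> permutes ?N"
    using vcg_rule_assignment[OF vcg] by (simp add: \<sigma>_def assignments_def)
  \<comment> \<open>Positions are renamed by their holders, which makes the identity the optimal
    assignment.\<close>
  define f where "f a c = posval k b a (\<sigma> c)" for a c
  obtain \<tau> where \<tau>: "\<tau> \<in> assignments n"
    and pay: "payment n k sel b i = total k b \<tau> (?N - {i}) - total k b \<sigma> (?N - {i})"
    unfolding \<sigma>_def by (rule payment_attained)
  define \<pi> where "\<pi> = inv \<sigma> \<circ> \<tau>"
  have pi: "\<pi> permutes ?N"
    unfolding \<pi>_def using \<tau> \<sigma> by (simp add: assignments_def permutes_compose permutes_inv)
  have tot: "total k b (\<sigma> \<circ> \<rho>) A = (\<Sum>a\<in>A. f a (\<rho> a))" for \<rho> A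
    by (simp add: total_def f_def)
  have tot\<tau>: "total k b \<tau> A = (\<Sum>a\<in>A. f a (\<pi> a))" for A
    using \<sigma> by (simp add: total_def f_def \<pi>_def permutes_inverses)
  have tot\<sigma>: "total k b \<sigma> A = (\<Sum>a\<in>A. f a a)" for A
    by (simp add: total_def f_def)
  have as: "\<sigma> \<circ> \<rho> \<in> assignments n" if "\<rho> permutes ?N" for \<rho>
    using that \<sigma> by (simp add: assignments_def permutes_compose)
  have "(\<Sum>a\<in>?N. f a (\<rho> a)) \<le> (\<Sum>a\<in>?N. f a a)" if "\<rho> permutes ?N" for \<rho>
    using vcg_rule_optimal[OF vcg as[OF that], of b] by (simp only: tot tot\<sigma> \<sigma>_def[symmetric])
  then obtain \<rho> where \<rho>: "\<rho> permutes ?N"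
    and le: "f i j + (\<Sum>a\<in>?N - {i}. f a (\<pi> a)) \<le> f j j + (\<Sum>a\<in>?N - {j}. f a (\<rho> a))"
    using exchange_at_optimum[OF _ _ _ pi, of i j f] i j by auto
  have "(\<Sum>a\<in>?N - {j}. f a (\<rho> a)) - (\<Sum>a\<in>?N - {j}. f a a) \<le> payment n k sel b j"
    using payment_ge[OF as[OF \<rho>], of k b j sel] by (simp only: tot tot\<sigma> \<sigma>_def[symmetric])
  \<comment> \<open>Both sides are the optimal total, split at \<open>i\<close> and at
    \<open>j\<close>; this links the two payments.\<close>
  moreover have "f i i + (\<Sum>a\<in>?N - {i}. f a a) = f j j + (\<Sum>a\<in>?N - {j}. f a a)"
    using sum.remove[of ?N i "\<lambda>a. f a a"] sum.remove[of ?N j "\<lambda>a. f a a"] i j by simp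
  ultimately have "f i j - payment n k sel b j \<le> f i i - payment n k sel b i"
    using le pay unfolding tot\<tau> tot\<sigma> by linarith
  then show ?thesis by (simp add: f_def \<sigma>_def)
qed

section \<open>Assignments, slot vectors and their order\<close>

lemma assignment_less: "\<sigma> \<in> assignments n \<Longrightarrow> \<sigma> a < n \<longleftrightarrow> a < n"
  using permutes_in_image[of \<sigma> "{..<n}" a] by (simp add: assignments_def)

lemma assignment_eq_iff: "\<sigma> \<in> assignments n \<Longrightarrow> \<sigma> a = \<sigma> b \<longleftrightarrow> a = b"
  using permutes_inj[of \<sigma> "{..<n}"] by (auto simp: assignments_def dest: injD)

lemma assignment_holder:
  assumes "\<sigma> \<in> assignments n" "q < n"
  obtains a where "a < n" "\<sigma> a = q"
proof -
  have "q \<in> \<sigma> ` {..<n}" using assms permutes_image[of \<sigma> "{..<n}"] by (simp add: assignments_def)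
  then show thesis using that by auto
qed

lemma good_beta_less:
  assumes "good_beta k \<beta>" "q < r" "q < k"
  shows "\<beta> r < \<beta> q"
proof (cases "r < k")
  case True
  from \<open>q < r\<close> True show ?thesis
  proof (induction r rule: less_induct)
    case (less r)
    then obtain r' where r': "r = Suc r'" by (cases r) auto
    have "\<beta> r < \<beta> r'" using assms(1) less.prems r' by (auto simp: good_beta_def)
    moreover have "\<beta> r' \<le> \<beta> q" using less r' by (cases "r' = q") force+
    ultimately show ?case by simp
  qed
next
  case False
  with assms show ?thesis by (auto simp: good_beta_def)
qed

lemma good_beta_nonneg: "good_beta k \<beta> \<Longrightarrow> 0 \<le> \<beta> q"
  by (cases "q < k") (auto simp: good_beta_def less_imp_le)

lemma good_beta_le_1:
  assumes "good_beta k \<beta>" "1 \<le> k"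
  shows "\<beta> q \<le> 1"
  using good_beta_less[OF assms(1), of 0 q] assms by (cases "q = 0") (auto simp: good_beta_def)

lemma posval_scaled:
  assumes "good_beta k \<beta>" "\<And>j. j < k \<Longrightarrow> \<theta> i j = \<beta> j * v i"
  shows "posval k \<theta> i q = \<beta> q * v i"
  using assms by (auto simp: posval_def good_beta_def)

lemma Psi_scaled:
  assumes "good_beta k \<beta>" "\<And>i. i < n \<Longrightarrow> 0 \<le> v i"
  shows "Psi n k (\<lambda>i j. \<beta> j * v i)"
  using assms by (auto simp: Psi_def)

text \<open>Swapping the two agents cannot raise the total. Only \<beta> is compared, since all
  positions from \<open>k\<close> on are worth the same.\<close>

lemma higher_value_higher_slot:
  assumes vcg: "vcg_rule n k sel"
    and val: "\<And>i q. i < n \<Longrightarrow> posval k \<theta> i q = \<beta> q * v i"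
    and a: "a < n" and b: "b < n" and less: "v b < v a"
  shows "\<beta> (sel \<theta> b) \<le> \<beta> (sel \<theta> a)"
proof -
  let ?\<sigma> = "sel \<theta>" and ?N = "{..<n}"
  have ab: "a \<noteq> b" using less by auto
  define \<tau> where "\<tau> = ?\<sigma> \<circ> Transposition.transpose a b"
  have "\<tau> \<in> assignments n"
    using vcg_rule_assignment[OF vcg, of \<theta>] a b permutes_swap_id[of a ?N b]
    by (auto simp: assignments_def \<tau>_def intro!: permutes_compose)
  then have le: "total k \<theta> \<tau> ?N \<le> total k \<theta> ?\<sigma> ?N"
    by (rule vcg_rule_optimal[OF vcg])
  have split: "total k \<theta> \<rho> ?N = posval k \<theta> a (\<rho> a) + (posval k \<theta> b (\<rho> b) + total k \<theta> \<rho> (?N - {a} - {b}))" for \<rho>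
    unfolding total_def
    using sum.remove[of ?N a "\<lambda>i. posval k \<theta> i (\<rho> i)"]
      sum.remove[of "?N - {a}" b "\<lambda>i. posval k \<theta> i (\<rho> i)"] a b ab by simp
  have "total k \<theta> \<tau> (?N - {a} - {b}) = total k \<theta> ?\<sigma> (?N - {a} - {b})"
    unfolding total_def by (rule sum.cong) (auto simp: \<tau>_def transpose_def)
  with le have "\<beta> (?\<sigma> b) * v a + \<beta> (?\<sigma> a) * v b \<le> \<beta> (?\<sigma> a) * v a + \<beta> (?\<sigma> b) * v b"
    using a b by (simp add: split val \<tau>_def)
  then have "0 \<le> (v a - v b) * (\<beta> (?\<sigma> a) - \<beta> (?\<sigma> b))" by (simp add: algebra_simps)
  then show ?thesis using less by (simp add: zero_le_mult_iff)
qed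

text \<open>The strict order of values leaves no tie to break before position \<open>z\<close>.
  Induction from the top: had \<open>a\<close> lost its position to some \<open>b\<close> aimed
  lower, then \<open>a\<close>, having the greater value, could sit no lower, yet everything above
  is taken.\<close>

lemma vcg_assignment_unique_on_top:
  assumes vcg: "vcg_rule n k sel" and beta: "good_beta k \<beta>"
    and val: "\<And>i q. i < n \<Longrightarrow> posval k \<theta> i q = \<beta> q * v i"
    and \<sigma>: "\<sigma> \<in> assignments n" and zk: "z \<le> k"
    and order: "\<And>a b. a < n \<Longrightarrow> b < n \<Longrightarrow> \<sigma> a < z \<Longrightarrow> \<sigma> a < \<sigma> b \<Longrightarrow> v b < v a"
    and a: "a < n" "\<sigma> a < z"
  shows "sel \<theta> a = \<sigma> a"
  using a
proof (induction "\<sigma> a" arbitrary: a rule: less_induct)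
  case less
  let ?s = "sel \<theta>"
  have s: "?s \<in> assignments n" using vcg by (rule vcg_rule_assignment)
  have fixed: "?s c = \<sigma> c" if "c < n" "\<sigma> c < \<sigma> a" for c
    using less that by simp
  have "\<sigma> a < n" using assignment_less[OF \<sigma>] less by simp
  then obtain b where b: "b < n" "?s b = \<sigma> a" using assignment_holder[OF s] by blast
  show ?case
  proof (cases "\<sigma> a < \<sigma> b")
    case True
    then have "\<beta> (\<sigma> a) \<le> \<beta> (?s a)"
      using higher_value_higher_slot[OF vcg val less.prems(1) b(1)] order less.prems b by auto
    then have "?s a \<le> \<sigma> a"
      using good_beta_less[OF beta, of "\<sigma> a" "?s a"] less.prems zk by force
    moreover have False if lt: "?s a < \<sigma> a"
    proof -
      obtain c where c: "c < n" "\<sigma> c = ?s a"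
        using assignment_holder[OF \<sigma>, of "?s a"] assignment_less[OF s] less.prems by auto
      then have "?s c = ?s a" using fixed lt by simp
      then have "c = a" using assignment_eq_iff[OF s] by simp
      with c lt show False by simp
    qed
    ultimately show ?thesis by force
  next
    case False
    then have "\<sigma> b = \<sigma> a" using fixed[OF b(1)] b(2) by force
    then have "b = a" using assignment_eq_iff[OF \<sigma>] by simp
    with b show ?thesis by simp
  qed
qed

text \<open>Induction from position 0 on: the positions before \<open>s a\<close> are taken by their
  holders under \<open>s\<close>, so \<open>a\<close> could only move down, which is
  excluded.\<close>

lemma assignment_rigid:
  assumes \<sigma>: "\<sigma> \<in> assignments n" and s: "s \<in> assignments n"
    and le: "\<And>a. a < n \<Longrightarrow> s a < w \<Longrightarrow> \<sigma> a \<le> s a"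
    and a: "a < n" "s a < w"
  shows "\<sigma> a = s a"
  using a
proof (induction "s a" arbitrary: a rule: less_induct)
  case less
  have False if lt: "\<sigma> a < s a"
  proof -
    obtain c where c: "c < n" "s c = \<sigma> a"
      using assignment_holder[OF s, of "\<sigma> a"] assignment_less[OF \<sigma>] less.prems by auto
    then have "\<sigma> c = \<sigma> a" using less lt by force
    then have "c = a" using assignment_eq_iff[OF \<sigma>] by simp
    with c lt show False by simp
  qed
  then show ?case using le[OF less.prems] by force
qed

lemma assignment_above:
  assumes \<sigma>: "\<sigma> \<in> assignments n" and s: "s \<in> assignments n" and w: "w \<le> n"
    and fixed: "\<And>a. a < n \<Longrightarrow> s a < w \<Longrightarrow> \<sigma> a = s a"
    and b: "w \<le> s b"
  shows "w \<le> \<sigma> b"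
proof (rule ccontr)
  assume "\<not> w \<le> \<sigma> b"
  then have lt: "\<sigma> b < w" by simp
  then obtain c where c: "c < n" "s c = \<sigma> b"
    using assignment_holder[OF s, of "\<sigma> b"] w by auto
  then have "\<sigma> c = \<sigma> b" using fixed lt by simp
  then have "c = b" using assignment_eq_iff[OF \<sigma>] by simp
  with c lt b show False by simp
qed

section \<open>Bid gaps forced by preserved Vickrey outcomes\<close>

text \<open>The difference of the payments of \<open>j\<close> and \<open>i\<close> lies between the
  two sides: envy-freeness of the messages at \<open>i\<close> gives the lower bound, that of the
  truthful bids at \<open>j\<close> the upper one. The right side carries the value of
  \<open>j\<close>, the holder of the position compared with.\<close>

lemma vickrey_preserving_messages:
  assumes vcg: "vcg_rule n k sel" and vp: "vickrey_preserving n k sel X"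
    and beta: "good_beta k \<beta>" and v: "\<And>i. i < n \<Longrightarrow> 0 \<le> v i"
  obtains m where "\<And>i. i < n \<Longrightarrow> m i \<in> X i" "sel m = sel (\<lambda>i j. \<beta> j * v i)"
    "\<And>i j. i < n \<Longrightarrow> j < n \<Longrightarrow>
      posval k m i (sel m j) - posval k m i (sel m i) \<le> v j * (\<beta> (sel m j) - \<beta> (sel m i))"
proof -
  let ?\<theta> = "\<lambda>i j. \<beta> j * v i"
  obtain m where m: "nash n k sel X ?\<theta> m" "sel m = sel ?\<theta>"
    and pay: "\<And>i. i < n \<Longrightarrow> payment n k sel m i = payment n k sel ?\<theta> i"
    using vp Psi_scaled[OF beta v] unfolding vickrey_preserving_def by meson
  show thesis
  proof (rule that[of m])
    fix i j assume ij: "i < n" "j < n"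
    have "posval k m i (sel m j) - posval k m i (sel m i) \<le> payment n k sel m j - payment n k sel m i"
      using clarke_payments_envy_free[OF vcg ij, of m] by simp
    also have "\<dots> = payment n k sel ?\<theta> j - payment n k sel ?\<theta> i"
      using pay ij by simp
    also have "\<dots> \<le> posval k ?\<theta> j (sel m j) - posval k ?\<theta> j (sel m i)"
      using clarke_payments_envy_free[OF vcg ij(2,1), of ?\<theta>] m(2) by simp
    also have "\<dots> = v j * (\<beta> (sel m j) - \<beta> (sel m i))"
      using posval_scaled[OF beta, of ?\<theta> j v] by (simp add: algebra_simps)
    finally show "posval k m i (sel m j) - posval k m i (sel m i) \<le> v j * (\<beta> (sel m j) - \<beta> (sel m i))" .
  qed (use m in \<open>auto simp: nash_def\<close>)
qed

section \<open>Equilibrium conditions for profiles that block displacement\<close>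

text \<open>
  \<open>s\<close> is the assignment aimed at; the agents below position \<open>z\<close> are those that get
  positive value from it.
\<close>

locale blocking_profile =
  fixes n k z :: nat and sel :: "profile \<Rightarrow> nat \<Rightarrow> nat" and m :: profile
    and s :: "nat \<Rightarrow> nat" and \<delta> B :: real
  assumes vcg: "vcg_rule n k sel" and s: "s \<in> assignments n" and zn: "z \<le> n"
    and up: "\<And>a q. a < n \<Longrightarrow> q < n \<Longrightarrow> posval k m a q - posval k m a (s a) \<le> \<delta>"
    and down: "\<And>a q. a < n \<Longrightarrow> s a < z \<Longrightarrow> q < n \<Longrightarrow> s a < q \<Longrightarrow>
      posval k m a q - posval k m a (s a) \<le> - B"
    and idle: "\<And>a q. a < n \<Longrightarrow> z \<le> s a \<Longrightarrow> q < n \<Longrightarrow> z \<le> q \<Longrightarrow>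
      posval k m a q \<le> posval k m a (s a)"
    and delta: "0 \<le> \<delta>" and B: "n * \<delta> < B"
begin

lemma total_diff:
  "total k m \<sigma> A - total k m s A = (\<Sum>a\<in>A. posval k m a (\<sigma> a) - posval k m a (s a))"
  by (simp add: total_def sum_subtractf)

lemma total_le:
  assumes \<sigma>: "\<sigma> \<in> assignments n" and A: "A \<subseteq> {..<n}"
  shows "total k m \<sigma> A \<le> total k m s A + n * \<delta>"
proof -
  have "(\<Sum>a\<in>A. posval k m a (\<sigma> a) - posval k m a (s a)) \<le> (\<Sum>a\<in>A. \<delta>)"
    using A assignment_less[OF \<sigma>] by (intro sum_mono up) auto
  also have "\<dots> \<le> n * \<delta>"
    using card_mono[OF _ A] delta by (simp add: mult_right_mono)
  finally show ?thesis using total_diff[of \<sigma> A] by simp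
qed

text \<open>One agent pushed down costs \<open>B\<close>, and all others together regain at most
  \<open>n * \<delta>\<close>, which is less than \<open>B\<close>.\<close>

lemma total_displaced:
  assumes \<sigma>: "\<sigma> \<in> assignments n" and A: "A \<subseteq> {..<n}"
    and a: "a \<in> A" "s a < z" "s a < \<sigma> a"
  shows "total k m \<sigma> A \<le> total k m s A + n * \<delta> - B"
proof -
  have fin: "finite A" using A finite_subset by blast
  have "total k m \<sigma> (A - {a}) \<le> total k m s (A - {a}) + n * \<delta>"
    using A by (intro total_le[OF \<sigma>]) auto
  moreover have "posval k m a (\<sigma> a) - posval k m a (s a) \<le> - B"
    using a A assignment_less[OF \<sigma>] by (intro down) auto
  moreover have "total k m \<rho> A = posval k m a (\<rho> a) + total k m \<rho> (A - {a})" for \<rho>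
    unfolding total_def using fin a(1) by (rule sum.remove)
  ultimately show ?thesis by simp
qed

lemma posval_le_if_fixed:
  assumes \<sigma>: "\<sigma> \<in> assignments n" and fixed: "\<And>a. a < n \<Longrightarrow> s a < z \<Longrightarrow> \<sigma> a = s a"
    and a: "a < n"
  shows "posval k m a (\<sigma> a) \<le> posval k m a (s a)"
proof (cases "s a < z")
  case False
  then have "z \<le> s a" by simp
  with idle[OF a] assignment_less[OF \<sigma>] a assignment_above[OF \<sigma> s zn fixed]
  show ?thesis by blast
qed (use fixed a in auto)

text \<open>Either an active agent is pushed down, at a net loss, or rigidity keeps all active
  agents in place and only idle ones move. Using a general \<open>A\<close> covers both the full
  total and the totals without one idle agent.\<close>

lemma total_le_or_displaced:
  assumes \<sigma>: "\<sigma> \<in> assignments n" and A: "A \<subseteq> {..<n}" "\<And>a. a < n \<Longrightarrow> s a < z \<Longrightarrow> a \<in> A"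
  shows "total k m \<sigma> A < total k m s A \<or>
    total k m \<sigma> A \<le> total k m s A \<and> (\<forall>a<n. s a < z \<longrightarrow> \<sigma> a = s a)"
proof (cases "\<exists>a<n. s a < z \<and> s a < \<sigma> a")
  case True
  then show ?thesis using total_displaced[OF \<sigma> A(1)] A(2) B by force
next
  case False
  then have fixed: "\<And>a. a < n \<Longrightarrow> s a < z \<Longrightarrow> \<sigma> a = s a"
    using assignment_rigid[OF \<sigma> s, of z] by force
  have "total k m \<sigma> A \<le> total k m s A"
    unfolding total_def using A(1) by (intro sum_mono posval_le_if_fixed[OF \<sigma> fixed]) auto
  with fixed show ?thesis by blast
qed

lemma s_optimal:
  assumes "\<sigma> \<in> assignments n"
  shows "total k m \<sigma> {..<n} \<le> total k m s {..<n}"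
  using total_le_or_displaced[OF assms, of "{..<n}"] by auto

lemma sel_assignment: "sel b \<in> assignments n"
  using vcg by (rule vcg_rule_assignment)

lemma sel_fixed: "a < n \<Longrightarrow> s a < z \<Longrightarrow> sel m a = s a"
  using total_le_or_displaced[OF sel_assignment[of m], of "{..<n}"]
    vcg_rule_optimal[OF vcg s, of m] by auto

lemma sel_idle: "z \<le> s a \<Longrightarrow> z \<le> sel m a"
  using assignment_above[OF sel_assignment s zn sel_fixed] .

text \<open>The rule may break ties among idle agents differently from \<open>s\<close>. Still no
  agent bids more for its position under \<open>sel m\<close> than for that under \<open>s\<close>,
  and the totals agree, so all terms agree.\<close>

lemma posval_sel:
  assumes a: "a < n"
  shows "posval k m a (sel m a) = posval k m a (s a)"
proof -
  have le: "posval k m c (sel m c) \<le> posval k m c (s c)" if "c < n" for c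
    using posval_le_if_fixed[OF sel_assignment sel_fixed that] .
  have "total k m s {..<n} = total k m (sel m) {..<n}"
    using vcg_rule_optimal[OF vcg s, of m] s_optimal[OF sel_assignment[of m]] by simp
  then show ?thesis
    using sum_mono_inv[of "\<lambda>a. posval k m a (sel m a)" "{..<n}" "\<lambda>a. posval k m a (s a)" a] le a
    by (simp add: total_def)
qed

lemma total_sel: "A \<subseteq> {..<n} \<Longrightarrow> total k m (sel m) A = total k m s A"
  unfolding total_def by (intro sum.cong) (auto simp: posval_sel)

lemma payment_small: "payment n k sel m i \<le> n * \<delta>"
proof -
  obtain \<tau> where "\<tau> \<in> assignments n"
    "payment n k sel m i = total k m \<tau> ({..<n} - {i}) - total k m (sel m) ({..<n} - {i})"
    by (rule payment_attained)
  then show ?thesis using total_le[of \<tau> "{..<n} - {i}"] total_sel[of "{..<n} - {i}"] by auto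
qed

text \<open>Without an idle agent all active ones are still present, so \<open>s\<close> stays
  optimal for the others.\<close>

lemma payment_idle:
  assumes "z \<le> s i"
  shows "payment n k sel m i = 0"
proof -
  obtain \<tau> where \<tau>: "\<tau> \<in> assignments n"
    "payment n k sel m i = total k m \<tau> ({..<n} - {i}) - total k m (sel m) ({..<n} - {i})"
    by (rule payment_attained)
  have "total k m \<tau> ({..<n} - {i}) \<le> total k m s ({..<n} - {i})"
    using total_le_or_displaced[OF \<tau>(1), of "{..<n} - {i}"] assms by force
  then show ?thesis
    using \<tau>(2) total_sel[of "{..<n} - {i}"] payment_nonneg[OF vcg, of m i] by auto
qed

text \<open>The maximum in the Clarke payment depends on the bids of the others only, so a deviation
  acts through the chosen assignment alone.\<close>

lemma payment_deviation:
  "payment n k sel (m(i := x)) i = payment n k sel m i + total k m s ({..<n} - {i})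
     - total k m (sel (m(i := x))) ({..<n} - {i})"
proof -
  have "total k (m(i := x)) \<sigma> ({..<n} - {i}) = total k m \<sigma> ({..<n} - {i})" for \<sigma>
    unfolding total_def posval_def by (rule sum.cong) auto
  then show ?thesis unfolding payment_def using total_sel[of "{..<n} - {i}"] by auto
qed

text \<open>Displacing another active agent raises the payment by at least
  \<open>B - n * \<delta>\<close>, more than the slot can be worth. Otherwise an active agent ends
  at its own position or lower, where the lost value covers any payment saved, and an idle agent
  ends at a worthless position and already pays 0.\<close>

lemma no_profitable_deviation:
  assumes i: "i < n"
    and val: "\<And>q. 0 \<le> posval k \<theta> i q" "\<And>q. posval k \<theta> i q + 2 * n * \<delta> \<le> B"
    and slack: "\<And>q. s i < z \<Longrightarrow> q < n \<Longrightarrow> s i < q \<Longrightarrow>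
      n * \<delta> \<le> posval k \<theta> i (s i) - posval k \<theta> i q"
    and idle_val: "\<And>q. z \<le> s i \<Longrightarrow> z \<le> q \<Longrightarrow> posval k \<theta> i q = 0"
  shows "utility n k sel \<theta> (m(i := x)) i \<le> utility n k sel \<theta> m i"
proof -
  let ?m = "m(i := x)" and ?N = "{..<n} - {i}"
  define \<sigma> where "\<sigma> = sel ?m"
  have \<sigma>: "\<sigma> \<in> assignments n" unfolding \<sigma>_def by (rule sel_assignment)
  have u': "utility n k sel \<theta> ?m i = posval k \<theta> i (\<sigma> i) - payment n k sel ?m i"
    by (simp add: utility_def \<sigma>_def)
  have p': "payment n k sel ?m i = payment n k sel m i + total k m s ?N - total k m \<sigma> ?N"
    unfolding \<sigma>_def by (rule payment_deviation)
  have p'0: "0 \<le> payment n k sel ?m i" and p0: "0 \<le> payment n k sel m i"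
    by (rule payment_nonneg[OF vcg])+
  note small = payment_small[of i]
  have u: "utility n k sel \<theta> m i = posval k \<theta> i (s i) - payment n k sel m i"
  proof (cases "s i < z")
    case True
    then show ?thesis by (simp add: utility_def sel_fixed i)
  next
    case False
    then show ?thesis using idle_val sel_idle[of i] by (simp add: utility_def)
  qed
  show ?thesis
  proof (cases "\<exists>a<n. a \<noteq> i \<and> s a < z \<and> s a < \<sigma> a")
    case True
    then have "total k m \<sigma> ?N \<le> total k m s ?N + n * \<delta> - B"
      using total_displaced[OF \<sigma>, of ?N] by auto
    then show ?thesis using u u' p' p0 small val(1)[of "s i"] val(2)[of "\<sigma> i"] by linarith
  next
    case False
    then have le: "\<And>a. a < n \<Longrightarrow> a \<noteq> i \<Longrightarrow> s a < z \<Longrightarrow> \<sigma> a \<le> s a" by force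
    show ?thesis
    proof (cases "s i < z")
      case True
      \<comment> \<open>With nobody above \<open>i\<close> moving down, everything above
        \<open>s i\<close> stays occupied, so \<open>i\<close> cannot rise.\<close>
      have "\<And>a. a < n \<Longrightarrow> s a < s i \<Longrightarrow> \<sigma> a = s a"
        using assignment_rigid[OF \<sigma> s, of "s i"] le True by force
      then have ge: "s i \<le> \<sigma> i"
        using assignment_above[OF \<sigma> s, of "s i" i] assignment_less[OF s, of i] i by simp
      show ?thesis
      proof (cases "\<sigma> i = s i")
        case True
        \<comment> \<open>Both assignments put \<open>i\<close> at the same position, so optimality
          of \<open>s\<close> under the original bids also holds for the others alone and the
          payment cannot fall.\<close>
        have "total k m \<rho> {..<n} = posval k m i (\<rho> i) + total k m \<rho> ?N" for \<rho>
          unfolding total_def using i by (intro sum.remove) auto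
        then have "total k m \<sigma> ?N \<le> total k m s ?N"
          using s_optimal[OF \<sigma>] True by simp
        then show ?thesis using u u' p' True by simp
      next
        case False
        then have "n * \<delta> \<le> posval k \<theta> i (s i) - posval k \<theta> i (\<sigma> i)"
          using slack True ge assignment_less[OF \<sigma>] i by simp
        then show ?thesis using u u' p'0 small by linarith
      qed
    next
      case idle_i: False
      then have "\<And>a. a < n \<Longrightarrow> s a < z \<Longrightarrow> \<sigma> a = s a"
        using assignment_rigid[OF \<sigma> s, of z] le by force
      then have "z \<le> \<sigma> i"
        using assignment_above[OF \<sigma> s zn] idle_i by force
      then show ?thesis
        using u u' idle_val idle_i payment_idle[of i] p'0 by simp
    qed
  qed
qed

lemma sel_efficient:
  assumes eff: "efficient n k \<theta> s"
    and idle_val: "\<And>i q. i < n \<Longrightarrow> z \<le> s i \<Longrightarrow> z \<le> q \<Longrightarrow> posval k \<theta> i q = 0"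
  shows "efficient n k \<theta> (sel m)"
proof -
  have "posval k \<theta> a (sel m a) = posval k \<theta> a (s a)" if "a < n" for a
    using that sel_fixed idle_val sel_idle[of a] by (cases "s a < z") auto
  then have "total k \<theta> (sel m) {..<n} = total k \<theta> s {..<n}"
    by (simp add: total_def)
  with eff sel_assignment show ?thesis by (simp add: efficient_def)
qed

lemma revenue_small: "revenue n k sel m \<le> n * (n * \<delta>)"
  using sum_mono[of "{..<n}" "payment n k sel m" "\<lambda>_. n * \<delta>"] payment_small
  by (simp add: revenue_def)

end

section \<open>Steep slot vectors and active slots\<close>

lemma steep_beta:
  assumes l: "l < k" and t: "0 < t"
  obtains \<beta> where "good_beta k \<beta>" "\<And>q. q < l \<Longrightarrow> \<beta> q - \<beta> l \<le> t"
    "\<And>q. l < q \<Longrightarrow> \<beta> q - \<beta> l \<le> - (1 / 2)"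
proof -
  \<comment> \<open>All small steps together stay within \<open>t\<close> and within 1/4, so values
    up to \<open>l\<close> are at least 3/4 and later ones at most 1/4.\<close>
  define \<eta> where "\<eta> = min (1 / 4) t / k"
  have k: "0 < real k" using l by simp
  have \<eta>: "0 < \<eta>" using k t by (simp add: \<eta>_def)
  have "real k * \<eta> = min (1 / 4) t" using k by (simp add: \<eta>_def)
  then have k\<eta>: "real k * \<eta> \<le> 1 / 4" "real k * \<eta> \<le> t" by simp_all
  have bound: "real j * \<eta> \<le> real k * \<eta>" if "j \<le> k" for j
    using that \<eta> by (simp add: mult_right_mono)
  \<comment> \<open>The subtraction \<open>k - q\<close> is on naturals, which gives the required 0
    from position \<open>k\<close> on.\<close>
  define \<beta> where "\<beta> q = (if q \<le> l then 1 - q * \<eta> else (k - q) * \<eta>)" for q :: nat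
  show thesis
  proof (rule that[of \<beta>])
    show "good_beta k \<beta>"
      unfolding good_beta_def
    proof (intro conjI allI impI)
      fix j assume j: "Suc j < k"
      consider "Suc j \<le> l" | "j = l" | "l < j" by linarith
      then show "\<beta> (Suc j) < \<beta> j"
      proof cases
        case 2
        then show ?thesis
          using bound[of j] bound[of "k - Suc j"] j k\<eta> by (simp add: \<beta>_def)
      qed (use \<eta> j in \<open>simp_all add: \<beta>_def algebra_simps of_nat_diff\<close>)
    next
      fix j assume j: "j < k"
      have "real j * \<eta> < 1" using bound[of j] k\<eta> j by linarith
      with j show "0 < \<beta> j" using \<eta> by (simp add: \<beta>_def)
    qed (use l in \<open>auto simp: \<beta>_def\<close>)
  next
    fix q assume "q < l"
    have "\<beta> q - \<beta> l = real l * \<eta> - real q * \<eta>" using \<open>q < l\<close> by (simp add: \<beta>_def)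
    moreover have "0 \<le> real q * \<eta>" using \<eta> by simp
    ultimately show "\<beta> q - \<beta> l \<le> t" using bound[of l] l k\<eta> by linarith
  next
    fix q assume "l < q"
    then show "\<beta> q - \<beta> l \<le> - (1 / 2)"
      using bound[of l] bound[of "k - q"] l k\<eta> by (simp add: \<beta>_def)
  qed
qed

text \<open>Take for \<open>z\<close> the first slot held by an agent of value 0, or
  \<open>k\<close> if there is none. An agent of positive value after such a slot would contradict
  \<open>higher_value_higher_slot\<close>. If \<open>z = k\<close>, agents without a slot may well
  have positive value.\<close>

lemma active_slots:
  assumes vcg: "vcg_rule n k sel" and beta: "good_beta k \<beta>"
    and val: "\<And>i q. i < n \<Longrightarrow> posval k \<theta> i q = \<beta> q * v i" and v: "\<And>i. i < n \<Longrightarrow> 0 \<le> v i"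
  obtains z where "z \<le> k" "\<And>a. a < n \<Longrightarrow> sel \<theta> a < z \<Longrightarrow> 0 < v a"
    "\<And>a. a < n \<Longrightarrow> z \<le> sel \<theta> a \<Longrightarrow> z < k \<Longrightarrow> v a = 0"
proof -
  let ?s = "sel \<theta>"
  have s: "?s \<in> assignments n" using vcg by (rule vcg_rule_assignment)
  define P where "P q \<longleftrightarrow> q = k \<or> (\<exists>b<n. ?s b = q \<and> v b = 0)" for q
  define z where "z = (LEAST q. P q)"
  have Pk: "P k" by (simp add: P_def)
  have Pz: "P z" unfolding z_def using Pk by (rule LeastI)
  have notP: "\<not> P q" if "q < z" for q using that not_less_Least unfolding z_def by blast
  show thesis
  proof (rule that[of z])
    show zk: "z \<le> k" unfolding z_def using Pk by (rule Least_le)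
    show "0 < v a" if "a < n" "?s a < z" for a
      using notP[OF that(2)] that v[OF that(1)] by (force simp: P_def)
    show "v a = 0" if a: "a < n" "z \<le> ?s a" and "z < k" for a
    proof -
      obtain b where b: "b < n" "?s b = z" "v b = 0" using Pz \<open>z < k\<close> by (auto simp: P_def)
      show ?thesis
      proof (rule ccontr)
        assume "v a \<noteq> 0"
        then have "v b < v a" using v[OF a(1)] b by simp
        then have "\<beta> z \<le> \<beta> (?s a)"
          using higher_value_higher_slot[OF vcg val a(1) b(1)] b by simp
        then have "?s a = z"
          using good_beta_less[OF beta, of z "?s a"] a \<open>z < k\<close> by force
        then have "a = b" using b assignment_eq_iff[OF s] by metis
        with b \<open>v a \<noteq> 0\<close> show False by simp
      qed
    qed
  qed
qed

section \<open>Assembling the cheap efficient equilibrium\<close>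

theorem theorem3:
  fixes n k :: nat and sel :: "profile \<Rightarrow> (nat \<Rightarrow> nat)" and X :: "nat \<Rightarrow> (nat \<Rightarrow> real) set"
    and \<theta> :: profile and \<epsilon> :: real
  assumes "1 \<le> k" and "k \<le> n"
    and "vcg_rule n k sel"
    and "vickrey_preserving n k sel X"
    and "Psi n k \<theta>" and "\<epsilon> > 0"
  shows "\<exists>m. nash n k sel X \<theta> m \<and> efficient n k \<theta> (sel m) \<and> revenue n k sel m \<le> \<epsilon>"
proof -
  note vcg = assms(3) and vp = assms(4)
  have n: "0 < real n" using assms by simp
  obtain \<beta> v where beta: "good_beta k \<beta>" and v: "\<And>i. i < n \<Longrightarrow> 0 \<le> v i"
    and \<theta>: "\<And>i j. i < n \<Longrightarrow> j < k \<Longrightarrow> \<theta> i j = \<beta> j * v i"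
    using assms(5) by (auto simp: Psi_def)
  have val: "posval k \<theta> i q = \<beta> q * v i" if "i < n" for i q
    using posval_scaled[OF beta] \<theta> that by simp
  obtain z where zk: "z \<le> k" and pos: "\<And>a. a < n \<Longrightarrow> sel \<theta> a < z \<Longrightarrow> 0 < v a"
    and zero: "\<And>a. a < n \<Longrightarrow> z \<le> sel \<theta> a \<Longrightarrow> z < k \<Longrightarrow> v a = 0"
    using active_slots[OF vcg beta val v] by blast
  let ?s\<^sub>0 = "sel \<theta>"
  have s\<^sub>0: "?s\<^sub>0 \<in> assignments n" using vcg by (rule vcg_rule_assignment)

  \<comment> \<open>These are the losses of active agents from moving down under the true values,
    finitely many and all positive.\<close>
  define G where "G = (\<lambda>(a, q). v a * (\<beta> (?s\<^sub>0 a) - \<beta> q)) `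
    {(a, q). a < n \<and> q < n \<and> ?s\<^sub>0 a < z \<and> ?s\<^sub>0 a < q}"
  have finG: "finite G"
    unfolding G_def by (rule finite_imageI, rule finite_subset[of _ "{..<n} \<times> {..<n}"]) auto
  have posG: "0 < g" if "g \<in> G" for g
  proof -
    obtain a q where "a < n" "?s\<^sub>0 a < z" "?s\<^sub>0 a < q" "g = v a * (\<beta> (?s\<^sub>0 a) - \<beta> q)"
      using \<open>g \<in> G\<close> by (auto simp: G_def)
    then show ?thesis using pos good_beta_less[OF beta, of "?s\<^sub>0 a" q] zk by simp
  qed
  \<comment> \<open>The first bound makes every loss in \<open>G\<close> cover a payment of
    \<open>n * \<delta>\<close>, the second keeps the revenue within \<epsilon>. Inserting 1 gives a
    minimum even if \<open>G\<close> is empty.\<close>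
  define \<delta> where "\<delta> = min (Min (insert 1 G) / n) (\<epsilon> / (n * n))"
  have Min: "0 < Min (insert 1 G)" using finG posG by auto
  have \<delta>: "0 < \<delta>" using Min n assms(6) by (simp add: \<delta>_def)
  have \<delta>G: "n * \<delta> \<le> g" if "g \<in> G" for g
  proof -
    have "n * \<delta> \<le> n * (Min (insert 1 G) / n)" using n by (intro mult_left_mono) (auto simp: \<delta>_def)
    also have "\<dots> \<le> g" using that finG n by simp
    finally show ?thesis .
  qed
  have \<delta>\<epsilon>: "n * (n * \<delta>) \<le> \<epsilon>"
  proof -
    have "n * (n * \<delta>) \<le> n * (n * (\<epsilon> / (n * n)))"
      using n by (intro mult_left_mono) (auto simp: \<delta>_def)
    also have "\<dots> = \<epsilon>" using n by simp
    finally show ?thesis .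
  qed
  define B where "B = (\<Sum>a<n. v a) + 2 * n * \<delta> + 1"
  have sumv: "v a \<le> (\<Sum>a<n. v a)" if "a < n" for a
    using that v by (intro member_le_sum) auto
  have sumv0: "0 \<le> (\<Sum>a<n. v a)" using v by (intro sum_nonneg) auto
  have n\<delta>: "0 \<le> n * \<delta>" using \<delta> by simp
  have B: "0 < B" "n * \<delta> < B" using sumv0 n\<delta> unfolding B_def by linarith+

  \<comment> \<open>Values for the common profile of the idle agents: 0 for them, at most \<delta>
    for all, and strictly decreasing along the active positions so that those are assigned as for
    \<theta>.\<close>
  define u where "u a = (if ?s\<^sub>0 a < z then \<delta> * (1 - ?s\<^sub>0 a / n) else 0)" for a
  have frac: "0 \<le> real (\<sigma> a) / n" "real (\<sigma> a) / n < 1" if "a < n" "\<sigma> \<in> assignments n" for a \<sigma>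
    using that assignment_less[of \<sigma> n a] n by simp_all
  have u: "0 \<le> u a" "u a \<le> \<delta>" if "a < n" for a
    using frac[OF that s\<^sub>0] \<delta> by (simp_all add: u_def mult_le_cancel_left1)
  obtain m0 where m0: "\<And>i. i < n \<Longrightarrow> m0 i \<in> X i" and sel0: "sel m0 = sel (\<lambda>i j. \<beta> j * u i)"
    and gap0: "\<And>i j. i < n \<Longrightarrow> j < n \<Longrightarrow>
      posval k m0 i (sel m0 j) - posval k m0 i (sel m0 i) \<le> u j * (\<beta> (sel m0 j) - \<beta> (sel m0 i))"
    using vickrey_preserving_messages[of n k sel X \<beta> u, OF vcg vp beta u(1)] by blast
  \<comment> \<open>Ties among the zero values may be broken differently than for \<theta>, so this
    assignment becomes the target; it agrees with \<open>sel \<theta>\<close> before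
    \<open>z\<close>.\<close>
  define s where "s = sel m0"
  have s: "s \<in> assignments n" unfolding s_def using vcg by (rule vcg_rule_assignment)
  have s_fixed: "s a = ?s\<^sub>0 a" if "a < n" "?s\<^sub>0 a < z" for a
    unfolding s_def sel0
  proof (rule vcg_assignment_unique_on_top[OF vcg beta _ s\<^sub>0 zk _ that])
    show "posval k (\<lambda>i j. \<beta> j * u i) i q = \<beta> q * u i" for i q
      using posval_scaled[OF beta] by simp
    show "u b < u c" if "c < n" "b < n" "?s\<^sub>0 c < z" "?s\<^sub>0 c < ?s\<^sub>0 b" for b c
      using that frac[OF \<open>c < n\<close> s\<^sub>0] \<delta> n by (auto simp: u_def divide_strict_right_mono)
  qed
  have s_iff: "s a < z \<longleftrightarrow> ?s\<^sub>0 a < z" if "a < n" for a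
    using s_fixed assignment_above[OF s s\<^sub>0 _ s_fixed, of z a] that zk assms(2) by force
  have idle_val: "posval k \<theta> a q = 0" if "a < n" "z \<le> s a" "z \<le> q" for a q
  proof (cases "z < k")
    case True
    then show ?thesis using zero[of a] s_iff[of a] that val by force
  next
    case False
    then show ?thesis using that by (simp add: posval_def)
  qed
  have eff: "efficient n k \<theta> s"
  proof -
    have "posval k \<theta> a (s a) = posval k \<theta> a (?s\<^sub>0 a)" if "a < n" for a
      using that s_fixed[OF that] s_iff[OF that] idle_val[OF that] by (cases "s a < z") auto
    then have "total k \<theta> s {..<n} = total k \<theta> ?s\<^sub>0 {..<n}" by (simp add: total_def)
    then show ?thesis using s vcg_rule_optimal[OF vcg] by (simp add: efficient_def)
  qed

  have "\<exists>m. (\<forall>i<n. m i \<in> X i) \<and> (\<forall>a<n. s a = l \<longrightarrow>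
      (\<forall>q<n. posval k m a q - posval k m a l \<le> \<delta> \<and>
        (l < q \<longrightarrow> posval k m a q - posval k m a l \<le> - B)))" if l: "l < z" for l
  proof -
    \<comment> \<open>The values \<open>w\<close> chosen below are at most \<open>2 * B + 1\<close>,
      so a rise of \<open>t\<close> in \<gamma> is worth at most \<delta>.\<close>
    define t where "t = \<delta> / (2 * B + 1)"
    have t: "0 < t" using \<delta> B by (simp add: t_def)
    obtain \<gamma> where \<gamma>: "good_beta k \<gamma>" and flat: "\<And>q. q < l \<Longrightarrow> \<gamma> q - \<gamma> l \<le> t"
      and drop: "\<And>q. l < q \<Longrightarrow> \<gamma> q - \<gamma> l \<le> - (1 / 2)"
      using steep_beta[of l k t] l zk t by auto
    \<comment> \<open>Being at least \<open>2 * B\<close>, these values turn the drop of 1/2 after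
      slot \<open>l\<close> into \<open>B\<close>. The fractional term orders the agents strictly
      along \<open>s\<close>.\<close>
    define w where "w a = 2 * B + (1 - s a / n)" for a
    have w: "2 * B \<le> w a" "w a \<le> 2 * B + 1" "0 \<le> w a" if "a < n" for a
      using frac[OF that s] B by (simp_all add: w_def)
    obtain m where mX: "\<And>i. i < n \<Longrightarrow> m i \<in> X i" and selm: "sel m = sel (\<lambda>i j. \<gamma> j * w i)"
      and gap: "\<And>i j. i < n \<Longrightarrow> j < n \<Longrightarrow>
        posval k m i (sel m j) - posval k m i (sel m i) \<le> w j * (\<gamma> (sel m j) - \<gamma> (sel m i))"
      using vickrey_preserving_messages[of n k sel X \<gamma> w, OF vcg vp \<gamma> w(3)] by blast
    have fixed: "sel m a = s a" if "a < n" "s a < k" for a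
      unfolding selm
    proof (rule vcg_assignment_unique_on_top[OF vcg \<gamma> _ s order_refl _ that])
      show "posval k (\<lambda>i j. \<gamma> j * w i) i q = \<gamma> q * w i" for i q
        using posval_scaled[OF \<gamma>] by simp
      show "w b < w c" if "s c < s b" for b c
        using that n by (simp add: w_def divide_strict_right_mono)
    qed
    have "posval k m a q - posval k m a l \<le> \<delta> \<and>
        (l < q \<longrightarrow> posval k m a q - posval k m a l \<le> - B)" if a: "a < n" "s a = l" and q: "q < n" for a q
    proof -
      \<comment> \<open>The holder is taken under \<open>sel m\<close>, since beyond the slots
        \<open>sel m\<close> and \<open>s\<close> may differ.\<close>
      obtain j where j: "j < n" "sel m j = q"
        using assignment_holder[OF vcg_rule_assignment[OF vcg] q] .
      have le: "posval k m a q - posval k m a l \<le> w j * (\<gamma> q - \<gamma> l)"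
        using gap[OF a(1) j(1)] fixed[OF a(1)] a l zk j by simp
      consider "q < l" | "q = l" | "l < q" by linarith
      then show ?thesis
      proof cases
        case 1
        have "w j * (\<gamma> q - \<gamma> l) \<le> w j * t"
          using flat[OF 1] w[OF j(1)] by (intro mult_left_mono)
        also have "\<dots> \<le> (2 * B + 1) * t"
          using w[OF j(1)] t by (intro mult_right_mono) auto
        also have "\<dots> = \<delta>" using B by (simp add: t_def)
        finally show ?thesis using le 1 by simp
      next
        case 2
        then show ?thesis using \<delta> by simp
      next
        case 3
        have "w j * (\<gamma> q - \<gamma> l) \<le> w j * (- (1 / 2))"
          using drop[OF 3] w[OF j(1)] by (intro mult_left_mono)
        also have "\<dots> \<le> - B" using w[OF j(1)] by simp
        finally show ?thesis using le B \<delta> by linarith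
      qed
    qed
    with mX show ?thesis by blast
  qed
  then obtain M where MX: "\<And>l i. l < z \<Longrightarrow> i < n \<Longrightarrow> M l i \<in> X i"
    and gap: "\<And>l a q. l < z \<Longrightarrow> a < n \<Longrightarrow> s a = l \<Longrightarrow> q < n \<Longrightarrow>
      posval k (M l) a q - posval k (M l) a l \<le> \<delta> \<and>
      (l < q \<longrightarrow> posval k (M l) a q - posval k (M l) a l \<le> - B)"
    by metis
  \<comment> \<open>Messages of different profiles can be mixed because the conditions of
    \<open>blocking_profile\<close> compare only bids of one and the same agent.\<close>
  define m where "m a = (if s a < z then M (s a) a else m0 a)" for a
  have mX: "m i \<in> X i" if "i < n" for i using that MX m0 by (simp add: m_def)
  have m_top: "posval k m a q = posval k (M (s a)) a q" if "s a < z" for a q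
    using that by (simp add: posval_def m_def)
  have m_idle: "posval k m a q = posval k m0 a q" if "z \<le> s a" for a q
    using that by (simp add: posval_def m_def)
  have gap_idle: "posval k m0 a q - posval k m0 a (s a) \<le> \<delta> \<and>
      (z \<le> q \<longrightarrow> posval k m0 a q \<le> posval k m0 a (s a))" if a: "a < n" and q: "q < n" for a q
  proof -
    obtain j where j: "j < n" "s j = q"
      using assignment_holder[OF s q] .
    have le: "posval k m0 a q - posval k m0 a (s a) \<le> u j * (\<beta> q - \<beta> (s a))"
      using gap0[OF a(1) j(1)] j by (simp add: s_def)
    have "u j * (\<beta> q - \<beta> (s a)) \<le> u j * 1"
      using good_beta_le_1[OF beta assms(1), of q] good_beta_nonneg[OF beta, of "s a"] u[OF j(1)]
      by (intro mult_left_mono) auto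
    \<comment> \<open>Holders of the positions from \<open>z\<close> on have auxiliary value 0,
      which makes the bound for idle agents exact.\<close>
    moreover have "u j = 0" if "z \<le> q"
      using that s_iff[OF j(1)] j by (simp add: u_def)
    ultimately show ?thesis using le u[OF j(1)] by auto
  qed
  interpret blocking_profile n k z sel m s \<delta> B
  proof
    show "posval k m a q - posval k m a (s a) \<le> \<delta>" if "a < n" "q < n" for a q
      using that gap[of "s a" a q] gap_idle[of a q] by (cases "s a < z") (simp_all add: m_top m_idle)
  qed (use vcg s zk assms(2) gap gap_idle \<delta> B in \<open>auto simp: m_top m_idle\<close>)
  have "nash n k sel X \<theta> m"
    unfolding nash_def
  proof (intro conjI allI impI ballI)
    fix i x assume i: "i < n"
    show "utility n k sel \<theta> (m(i := x)) i \<le> utility n k sel \<theta> m i"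
    proof (rule no_profitable_deviation[OF i])
      show "0 \<le> posval k \<theta> i q" for q
        using val[OF i] v[OF i] good_beta_nonneg[OF beta] by simp
      have "\<beta> q * v i \<le> v i" for q
        using v[OF i] good_beta_le_1[OF beta assms(1)] by (simp add: mult_left_le_one_le good_beta_nonneg[OF beta])
      then show "posval k \<theta> i q + 2 * n * \<delta> \<le> B" for q
        using val[OF i, of q] sumv[OF i] by (simp add: B_def) (smt (verit))
      show "n * \<delta> \<le> posval k \<theta> i (s i) - posval k \<theta> i q" if "s i < z" "q < n" "s i < q" for q
      proof -
        have "v i * (\<beta> (?s\<^sub>0 i) - \<beta> q) \<in> G"
          using that i s_iff[OF i] s_fixed[OF i] by (auto simp: G_def)
        from \<delta>G[OF this] show ?thesis
          using val[OF i] s_fixed[OF i] s_iff[OF i] that by (simp add: algebra_simps)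
      qed
    qed (use idle_val i in auto)
  qed (use mX in auto)
  moreover have "efficient n k \<theta> (sel m)"
    using sel_efficient[OF eff idle_val] .
  moreover have "revenue n k sel m \<le> \<epsilon>"
    using revenue_small \<delta>\<epsilon> by linarith
  ultimately show ?thesis by blast
qed

end
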